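(* For $\lambda>0$ let $\mathbf H_{GR}(\alpha,\lambda)$ ($\alpha>0$) and $\mathbf H_{GR}(\alpha,\beta,\lambda)$ ($\alpha,\beta>0$, $\alpha\ne\beta$) be the one- and two-parameter generalized Rényi entropies of the Poisson distribution with parameter $\lambda$ (see context). 1. Let $\alpha,\beta>0$ with $\alpha\le1<\beta$ or $\alpha>1\ge\beta$. Then $\mathbf H_{GR}(\alpha,\beta,\lambda)$ increases as a function of $\lambda\in(0,\infty)$. 2. Let $J$ be a subset of $(0,1)$ or a subset of $(1,\infty)$ such that, for each $\alpha\in J$, the function $\lambda\mapsto\mathbf H_{GR}(\alpha,\lambda)$ is decreasing on some (nondegenerate) interval, which may depend on $\alpha$. Then, for each $\alpha\in J$ and for each $\beta\neq\alpha$ in a neighborhood of $\alpha$, the function $\lambda\mapsto\mathbf H_{GR}(\alpha,\beta,\lambda)$ is also decreasing on some (nondegenerate) interval, which may depend on $\alpha$ and $\beta$.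
   Context: For $\lambda>0$ let $p_i(\lambda)=e^{-\lambda}\lambda^i/i!$, $i\ge0$ (Poisson distribution). The generalized Rényi entropies are $$\mathbf H_{GR}(\alpha,\lambda)=-\frac{\sum_{i=0}^\infty p_i(\lambda)^\alpha\log p_i(\lambda)}{\sum_{i=0}^\infty p_i(\lambda)^\alpha}\quad(\alpha>0),$$ $$\mathbf H_{GR}(\alpha,\beta,\lambda)=\frac1{\beta-\alpha}\log\frac{\sum_{i=0}^\infty p_i(\lambda)^\alpha}{\sum_{i=0}^\infty p_i(\lambda)^\beta}\quad(\alpha,\beta>0,\ \alpha\ne\beta).$$ *)

theory Defs
  imports "HOL-Probability.Probability"
begin

definition poisson_prob :: "real \<Rightarrow> nat \<Rightarrow> real" where
  "poisson_prob l i = exp (- l) * l ^ i / fact i"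

lemma poisson_prob_eq_pmf: "l > 0 \<Longrightarrow> poisson_prob l i = pmf (poisson_pmf l) i"
  by (simp add: poisson_prob_def)

text \<open>
  For \<open>\<alpha>, \<beta>, l > 0\<close> all the series below converge absolutely, and all the
  arguments of the logarithms are positive; the definitions are only meant for that range
  (and \<open>\<alpha> \<noteq> \<beta>\<close> in the two-parameter case).
\<close>

definition H_GR1 :: "real \<Rightarrow> real \<Rightarrow> real" where
  "H_GR1 \<alpha> l =
     - (\<Sum>i. poisson_prob l i powr \<alpha> * ln (poisson_prob l i)) / (\<Sum>i. poisson_prob l i powr \<alpha>)"

definition H_GR2 :: "real \<Rightarrow> real \<Rightarrow> real \<Rightarrow> real" where
  "H_GR2 \<alpha> \<beta> l =
     1 / (\<beta> - \<alpha>) * ln ((\<Sum>i. poisson_prob l i powr \<alpha>) / (\<Sum>i. poisson_prob l i powr \<beta>))"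

text \<open>
  Every nondegenerate interval contains a nonempty open one, so asking for an open interval
  is no restriction. The left endpoint may be \<open>0\<close>.
\<close>

definition decreasing_on_some_interval :: "(real \<Rightarrow> real) \<Rightarrow> bool" where
  "decreasing_on_some_interval f \<longleftrightarrow> (\<exists>a b. 0 \<le> a \<and> a < b \<and> strict_antimono_on {a<..<b} f)"

end

theory Submission
  imports Defs
begin

text \<open>
  For a fixed \<open>a > 0\<close> the sum \<open>S(a, l)\<close> of the \<open>a\<close>-th powers of the Poisson probabilities is
  \<open>exp (- a l)\<close> times an everywhere convergent power series in \<open>l powr a\<close>. With the weights
  \<open>w n = (l powr a) ^ n / n! powr a\<close> one has \<open>\<Sum> ((n / l) powr a - 1) w n = 0\<close> by an index shift,
  while \<open>\<Sum> (n / l - 1) w n\<close> has the sign of the derivative of \<open>S(a, l)\<close> in \<open>l\<close>; Bernoulli's inequality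
  for \<open>(n / l) powr a\<close> therefore makes \<open>S(a, l)\<close> increase for \<open>a < 1\<close> and decrease for \<open>a > 1\<close>.

  For the second part no joint smoothness in the exponent and \<open>l\<close> is needed. If the one-parameter
  entropy drops from \<open>x\<close> to \<open>y\<close>, then so does the two-parameter entropy once \<open>\<beta>\<close> is close to
  \<open>\<alpha>\<close>, by pointwise convergence; being continuously differentiable in \<open>l\<close>, it has a negative
  derivative somewhere between \<open>x\<close> and \<open>y\<close>, hence on an interval.
\<close>

section \<open>Bernoulli's inequality for real exponents\<close>

lemma Bernoulli_powr_le:
  fixes x a :: real
  assumes "0 < a" "a < 1" "0 \<le> x"
  shows "x powr a \<le> 1 + a * (x - 1)"
proof (cases "x = 0")
  case False
  \<comment> \<open>Weighted AM-GM for \<open>x\<close> and \<open>1\<close> with weights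
    \<open>a\<close> and \<open>1 - a\<close>.\<close>
  then show ?thesis
    using Youngs_inequality_0[of a "1 - a" x 1] assms by (simp add: algebra_simps)
qed (use assms in simp)

text \<open>The concave case, with exponent \<open>1 / a\<close> at the point
  \<open>x powr a\<close>, rearranges to this.\<close>

lemma Bernoulli_powr_ge:
  fixes x a :: real
  assumes "1 < a" "0 \<le> x"
  shows "1 + a * (x - 1) \<le> x powr a"
proof -
  have "x \<le> 1 + 1 / a * (x powr a - 1)"
    using Bernoulli_powr_le[of "1 / a" "x powr a"] assms by (simp add: powr_powr)
  then show ?thesis
    using assms by (simp add: field_simps)
qed

section \<open>From a drop between two points to an interval of decrease\<close>

lemma decreasing_on_some_interval_C1:
  fixes f f' :: "real \<Rightarrow> real"
  assumes deriv: "\<And>x. 0 < x \<Longrightarrow> (f has_real_derivative f' x) (at x)"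
    and cont: "continuous_on {0<..} f'"
    and xy: "0 < x" "x < y" "f y < f x"
  shows "decreasing_on_some_interval f"
proof -
  obtain z where z: "x < z" "z < y" "f y - f x = (y - x) * f' z"
    using MVT2[OF xy(2), of f f'] deriv xy(1) by force
  have "f' z < 0"
    using z(3) xy mult_nonneg_nonneg[of "y - x" "f' z"] by linarith
  moreover have "(f' \<longlongrightarrow> f' z) (at z)"
    using cont z(1) xy(1) by (simp add: continuous_on_eq_continuous_at isCont_def)
  ultimately have "\<forall>\<^sub>F u in at z. f' u < 0"
    by (simp add: order_tendstoD)
  then obtain d where d: "d > 0" "\<And>u. u \<noteq> z \<Longrightarrow> dist u z < d \<Longrightarrow> f' u < 0"
    unfolding eventually_at by blast
  \<comment> \<open>An interval just left of \<open>z\<close> suffices; cutting it off at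
    \<open>x\<close> keeps it inside the positive reals, where \<open>f\<close> is
    differentiable.\<close>
  define a where "a = max x (z - d)"
  have a: "0 < a" "a < z" "z - d \<le> a"
    using z xy d by (auto simp: a_def)
  have neg: "f' u < 0" if "a < u" "u < z" for u
    using d(2)[of u] that a by (auto simp: dist_real_def)
  have "strict_antimono_on {a<..<z} f"
  proof (rule monotone_onI)
    fix u v assume uv: "u \<in> {a<..<z}" "v \<in> {a<..<z}" "u < v"
    show "f v < f u"
    proof (rule DERIV_neg_imp_decreasing[OF uv(3)])
      fix w assume w: "u \<le> w" "w \<le> v"
      have "0 < w" "f' w < 0"
        using neg[of w] w uv a by auto
      then show "\<exists>D. DERIV f w :> D \<and> D < 0"
        using deriv by blast
    qed
  qed
  then show ?thesis
    unfolding decreasing_on_some_interval_def using a by (meson less_imp_le)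
qed

section \<open>Power series with coefficients \<open>fact n powr - a\<close>\<close>

lemma summable_fact_powr_power_series:
  fixes a x :: real
  assumes "0 < a"
  shows "summable (\<lambda>n. fact n powr - a * x ^ n)"
proof -
  \<comment> \<open>This is the ratio of the absolute values of consecutive terms; as it tends to 0,
    the radius of convergence is infinite.\<close>
  have "((\<lambda>n. \<bar>x\<bar> * real (Suc n) powr - a) \<longlongrightarrow> \<bar>x\<bar> * 0) sequentially"
    by (intro tendsto_mult tendsto_const tendsto_neg_powr filterlim_compose[OF filterlim_real_sequentially filterlim_Suc])
       (use assms in auto)
  then have "\<forall>\<^sub>F n in sequentially. \<bar>x\<bar> * real (Suc n) powr - a < 1 / 2"
    by (intro order_tendstoD) auto
  then obtain N where N: "\<And>n. n \<ge> N \<Longrightarrow> \<bar>x\<bar> * real (Suc n) powr - a < 1 / 2"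
    by (auto simp: eventually_sequentially)
  show ?thesis
  proof (rule summable_ratio_test[of "1 / 2" N])
    fix n assume "n \<ge> N"
    then have "(\<bar>x\<bar> * real (Suc n) powr - a) * norm (fact n powr - a * x ^ n)
        \<le> 1 / 2 * norm (fact n powr - a * x ^ n)"
      using N[of n] by (intro mult_right_mono) auto
    moreover have "norm (fact (Suc n) powr - a * x ^ Suc n)
        = (\<bar>x\<bar> * real (Suc n) powr - a) * norm (fact n powr - a * x ^ n)"
      by (simp add: powr_mult abs_mult power_abs del: of_nat_Suc)
    ultimately show "norm (fact (Suc n) powr - a * x ^ Suc n) \<le> 1 / 2 * norm (fact n powr - a * x ^ n)"
      by simp
  qed simp
qed

text \<open>The normalizing constant of the Conway-Maxwell-Poisson distribution; for
  \<open>a = 1\<close> it is \<open>exp x\<close>.\<close>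

definition fact_powr_series :: "real \<Rightarrow> real \<Rightarrow> real" where
  "fact_powr_series a x = (\<Sum>n. fact n powr - a * x ^ n)"

definition fact_powr_series' :: "real \<Rightarrow> real \<Rightarrow> real" where
  "fact_powr_series' a x = (\<Sum>n. diffs (\<lambda>n. fact n powr - a) n * x ^ n)"

lemma fact_powr_series_deriv:
  assumes "0 < a"
  shows "(fact_powr_series a has_real_derivative fact_powr_series' a x) (at x)"
  unfolding fact_powr_series_def[abs_def] fact_powr_series'_def
  using summable_fact_powr_power_series[OF assms] by (rule termdiffs_strong_converges_everywhere)

lemma isCont_fact_powr_series':
  assumes "0 < a"
  shows "isCont (fact_powr_series' a) x"
  unfolding fact_powr_series'_def[abs_def]
  by (intro DERIV_isCont[OF termdiffs_strong_converges_everywhere] termdiff_converges_all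
      summable_fact_powr_power_series assms)

section \<open>Power sums of the Poisson probabilities\<close>

lemma poisson_prob_powr:
  assumes "0 < l"
  shows "poisson_prob l n powr a = exp (- a * l) * (fact n powr - a * (l powr a) ^ n)"
proof -
  have "(l ^ n) powr a = (l powr a) ^ n"
    using assms by (simp add: powr_powr mult.commute flip: powr_realpow)
  then show ?thesis
    using assms by (simp add: poisson_prob_def powr_mult powr_divide powr_minus_divide exp_powr_real mult.commute)
qed

definition poisson_power_sum :: "real \<Rightarrow> real \<Rightarrow> real" where
  "poisson_power_sum a l = (\<Sum>i. poisson_prob l i powr a)"

lemma summable_poisson_prob_powr:
  assumes "0 < a" "0 < l"
  shows "summable (\<lambda>i. poisson_prob l i powr a)"
  unfolding poisson_prob_powr[OF assms(2)]
  by (intro summable_mult summable_fact_powr_power_series assms)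

text \<open>Separating the exponential factor leaves a power series in \<open>l powr a\<close>, so
  the dependence on \<open>l\<close> can be differentiated termwise.\<close>

lemma poisson_power_sum_eq:
  assumes "0 < a" "0 < l"
  shows "poisson_power_sum a l = exp (- a * l) * fact_powr_series a (l powr a)"
  unfolding poisson_power_sum_def fact_powr_series_def poisson_prob_powr[OF assms(2)]
  by (intro suminf_mult summable_fact_powr_power_series assms)

lemma poisson_prob_pos: "0 < l \<Longrightarrow> 0 < poisson_prob l i"
  by (simp add: poisson_prob_def)

lemma poisson_prob_sums_one: "0 < l \<Longrightarrow> poisson_prob l sums 1"
  using sums_mult[OF exp_converges[of l], of "exp (- l)"]
  by (simp add: poisson_prob_def[abs_def] divide_inverse mult_ac flip: exp_add)

lemma poisson_prob_le_one:
  assumes "0 < l"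
  shows "poisson_prob l i \<le> 1"
  using sum_le_suminf[of "poisson_prob l" "{i}"] poisson_prob_sums_one[OF assms]
    poisson_prob_pos[OF assms] by (auto simp: sums_iff less_imp_le)

lemma poisson_power_sum_pos:
  assumes "0 < a" "0 < l"
  shows "0 < poisson_power_sum a l"
  unfolding poisson_power_sum_def
  using summable_poisson_prob_powr[OF assms] poisson_prob_pos[OF assms(2), of 0]
  by (intro suminf_pos2[of _ 0]) auto

text \<open>Product and chain rule, with the positive factor \<open>a * exp (- a * l)\<close> pulled
  out.\<close>

definition poisson_power_sum' :: "real \<Rightarrow> real \<Rightarrow> real" where
  "poisson_power_sum' a l =
     a * exp (- a * l) * (l powr (a - 1) * fact_powr_series' a (l powr a) - fact_powr_series a (l powr a))"

lemma poisson_power_sum_deriv: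
  assumes "0 < a" "0 < l"
  shows "(poisson_power_sum a has_real_derivative poisson_power_sum' a l) (at l)"
proof -
  have "((\<lambda>l. exp (- a * l) * fact_powr_series a (l powr a)) has_real_derivative
      poisson_power_sum' a l) (at l)"
    using assms
    by (auto intro!: derivative_eq_intros DERIV_chain2[OF fact_powr_series_deriv]
        simp: poisson_power_sum'_def algebra_simps)
  then show ?thesis
    by (rule has_field_derivative_transform_within_open[of _ _ _ "{0<..}"])
       (use assms in \<open>auto simp: poisson_power_sum_eq\<close>)
qed

lemma continuous_on_poisson_power_sum':
  assumes "0 < a"
  shows "continuous_on {0<..} (poisson_power_sum' a)"
proof -
  have powr: "continuous_on {0<..} (\<lambda>l. l powr a)"
    by (intro continuous_intros) auto
  have "continuous_on UNIV (fact_powr_series' a)" "continuous_on UNIV (fact_powr_series a)"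
    using isCont_fact_powr_series'[OF assms] DERIV_isCont[OF fact_powr_series_deriv[OF assms]]
    by (simp_all add: continuous_at_imp_continuous_on)
  from this[THEN continuous_on_compose2, OF powr subset_UNIV]
  show ?thesis
    unfolding poisson_power_sum'_def[abs_def] by (intro continuous_intros) auto
qed

section \<open>Sign of the derivative in \<open>l\<close>\<close>

lemma poisson_power_sum'_sums:
  assumes "0 < a" "0 < l"
  defines "w \<equiv> \<lambda>n. fact n powr - a * (l powr a) ^ n"
  shows "(\<lambda>n. a * (real n / l - 1) * w n) sums (exp (a * l) * poisson_power_sum' a l)"
    and "(\<lambda>n. ((real n / l) powr a - 1) * w n) sums 0"
proof -
  have w: "w sums fact_powr_series a (l powr a)"
    unfolding w_def fact_powr_series_def
    by (intro summable_sums summable_fact_powr_power_series assms)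
  have "(\<lambda>n. diffs (\<lambda>n. fact n powr - a) n * (l powr a) ^ n) sums fact_powr_series' a (l powr a)"
    unfolding fact_powr_series'_def
    by (intro summable_sums termdiff_converges_all summable_fact_powr_power_series assms)
  from sums_mult[OF this, of "l powr (a - 1)"]
  have "(\<lambda>n. real (Suc n) / l * w (Suc n)) sums (l powr (a - 1) * fact_powr_series' a (l powr a))"
    using assms(2) by (simp add: diffs_def w_def powr_diff mult_ac)
  \<comment> \<open>The term at \<open>n = 0\<close> vanishes, so shifting the index back leaves the
    sum unchanged.\<close>
  then have "(\<lambda>n. real n / l * w n) sums (l powr (a - 1) * fact_powr_series' a (l powr a))"
    by (subst (asm) sums_Suc_iff) simp
  moreover have "exp (a * l) * poisson_power_sum' a l
      = a * (l powr (a - 1) * fact_powr_series' a (l powr a) - fact_powr_series a (l powr a))"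
    by (simp add: poisson_power_sum'_def exp_minus)
  ultimately show "(\<lambda>n. a * (real n / l - 1) * w n) sums (exp (a * l) * poisson_power_sum' a l)"
    using sums_mult[OF sums_diff[OF _ w], of _ _ a] by (simp add: left_diff_distrib mult.assoc)
  have "(real (Suc n) / l) powr a * w (Suc n) = w n" for n
    using assms(2) by (simp add: w_def powr_mult powr_divide powr_minus_divide del: of_nat_Suc)
  then have "(\<lambda>n. (real (Suc n) / l) powr a * w (Suc n)) sums fact_powr_series a (l powr a)"
    using w by simp
  \<comment> \<open>Again no term is added at \<open>n = 0\<close>, because
    \<open>0 powr a = 0\<close>.\<close>
  then have "(\<lambda>n. (real n / l) powr a * w n) sums fact_powr_series a (l powr a)"
    by (subst (asm) sums_Suc_iff) simp
  from sums_diff[OF this w]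
  show "(\<lambda>n. ((real n / l) powr a - 1) * w n) sums 0"
    by (simp add: algebra_simps)
qed

lemma poisson_power_sum'_neg:
  assumes "1 < a" "0 < l"
  shows "poisson_power_sum' a l < 0"
proof -
  let ?w = "\<lambda>n. fact n powr - a * (l powr a) ^ n"
  note S = poisson_power_sum'_sums[of a l]
  have d: "(\<lambda>n. ((real n / l) powr a - 1 - a * (real n / l - 1)) * ?w n) sums
      (0 - exp (a * l) * poisson_power_sum' a l)"
    using sums_diff[OF S(2) S(1)] assms by (simp add: algebra_simps)
  have "0 \<le> (real n / l) powr a - 1 - a * (real n / l - 1)" for n
    using Bernoulli_powr_ge[of a "real n / l"] assms by simp
  \<comment> \<open>Strictness comes from the term at \<open>n = 0\<close>, which equals
    \<open>a - 1\<close>.\<close>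
  then have "0 < (\<Sum>n. ((real n / l) powr a - 1 - a * (real n / l - 1)) * ?w n)"
    using assms by (intro suminf_pos2[of _ 0] sums_summable[OF d] mult_nonneg_nonneg) auto
  then show ?thesis
    unfolding sums_unique[OF d, symmetric] by (simp add: mult_less_0_iff)
qed

lemma poisson_power_sum'_pos:
  assumes "0 < a" "a < 1" "0 < l"
  shows "0 < poisson_power_sum' a l"
proof -
  let ?w = "\<lambda>n. fact n powr - a * (l powr a) ^ n"
  note S = poisson_power_sum'_sums[of a l]
  have d: "(\<lambda>n. (a * (real n / l - 1) - ((real n / l) powr a - 1)) * ?w n) sums
      (exp (a * l) * poisson_power_sum' a l - 0)"
    using sums_diff[OF S(1) S(2)] assms by (simp add: algebra_simps)
  have "0 \<le> a * (real n / l - 1) - ((real n / l) powr a - 1)" for n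
    using Bernoulli_powr_le[of a "real n / l"] assms by simp
  \<comment> \<open>Here the term at \<open>n = 0\<close> is \<open>1 - a\<close>, again
    positive.\<close>
  then have "0 < (\<Sum>n. (a * (real n / l - 1) - ((real n / l) powr a - 1)) * ?w n)"
    using assms by (intro suminf_pos2[of _ 0] sums_summable[OF d] mult_nonneg_nonneg) auto
  then show ?thesis
    unfolding sums_unique[OF d, symmetric] by (simp add: zero_less_mult_iff)
qed

lemma poisson_power_sum_strict_antimono:
  assumes "1 < a" "0 < x" "x < y"
  shows "poisson_power_sum a y < poisson_power_sum a x"
proof (rule DERIV_neg_imp_decreasing[OF assms(3)])
  fix z assume "x \<le> z" "z \<le> y"
  then show "\<exists>D. DERIV (poisson_power_sum a) z :> D \<and> D < 0"
    using poisson_power_sum_deriv[of a z] poisson_power_sum'_neg[of a z] assms by force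
qed

lemma poisson_power_sum_mono:
  assumes "0 < a" "a \<le> 1" "0 < x" "x < y"
  shows "poisson_power_sum a x \<le> poisson_power_sum a y"
proof (cases "a = 1")
  case True
  \<comment> \<open>For exponent 1 the sum is the total mass and hence constant, which is why the
    lemma claims only weak monotonicity.\<close>
  have "poisson_power_sum 1 l = 1" if "0 < l" for l
    using poisson_prob_sums_one[OF that] poisson_prob_pos[OF that]
    by (simp add: poisson_power_sum_def sums_iff less_imp_le)
  then show ?thesis
    using True assms by simp
next
  case False
  show ?thesis
  proof (rule DERIV_nonneg_imp_nondecreasing[of x y])
    fix z assume "x \<le> z" "z \<le> y"
    then show "\<exists>D. DERIV (poisson_power_sum a) z :> D \<and> D \<ge> 0"
      using poisson_power_sum_deriv[of a z] poisson_power_sum'_pos[of a z] assms False by force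
  qed (use assms in simp)
qed

section \<open>Differentiation in the exponent\<close>

lemma poisson_power_sum_deriv_exponent:
  assumes "0 < a" "0 < l"
  shows "((\<lambda>a. poisson_power_sum a l) has_real_derivative
     (\<Sum>i. poisson_prob l i powr a * ln (poisson_prob l i))) (at a)"
proof -
  let ?p = "poisson_prob l"
  have p: "0 < ?p i" "?p i \<le> 1" for i
    using poisson_prob_pos poisson_prob_le_one assms by auto
  \<comment> \<open>A summable majorant, uniform in \<open>b\<close> near \<open>a\<close>: of the
    exponent \<open>a / 2\<close> guaranteed by \<open>b\<close>, a part \<open>a / 4\<close>
    absorbs the logarithm and \<open>a / 4\<close> remains for convergence.\<close>
  have bound: "norm (?p i powr b * ln (?p i)) \<le> 4 / a * ?p i powr (a / 4)" if "b \<in> {a/2..2*a}" for i b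
  proof -
    have "- ln (?p i) \<le> ?p i powr - (a / 4) / (a / 4)"
      using ln_powr_bound[of "1 / ?p i" "a / 4"] p[of i] assms
      by (simp add: ln_div powr_divide powr_minus_divide)
    moreover have "?p i powr b \<le> ?p i powr (a / 2)"
      using p[of i] that by (intro powr_mono') auto
    ultimately have "?p i powr b * - ln (?p i) \<le> ?p i powr (a / 2) * (?p i powr - (a / 4) / (a / 4))"
      using p[of i] by (intro mult_mono) auto
    also have "\<dots> = 4 / a * (?p i powr (a / 2) * ?p i powr - (a / 4))"
      by simp
    also have "\<dots> = 4 / a * ?p i powr (a / 4)"
      by (simp flip: powr_add)
    finally show ?thesis
      using p[of i] by (simp add: abs_mult)
  qed
  have "uniformly_convergent_on {a/2..2*a} (\<lambda>n b. \<Sum>i<n. ?p i powr b * ln (?p i))"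
    using bound
    by (rule Weierstrass_m_test') (use assms in \<open>auto intro!: summable_mult summable_poisson_prob_powr\<close>)
  moreover have "((\<lambda>b. ?p i powr b) has_real_derivative ?p i powr b * ln (?p i)) (at b within S)" for i b S
    using p(1)[of i] by (auto simp: powr_def intro!: derivative_eq_intros)
  ultimately show ?thesis
    unfolding poisson_power_sum_def
    using assms summable_poisson_prob_powr[OF assms]
    by (intro has_field_derivative_series'(2)[of "{a/2..2*a}" _ _ a]) auto
qed

section \<open>The generalized Renyi entropies\<close>

lemma H_GR2_eq:
  assumes "0 < a" "0 < b" "0 < l"
  shows "H_GR2 a b l = (ln (poisson_power_sum a l) - ln (poisson_power_sum b l)) / (b - a)"
  using poisson_power_sum_pos[of a l] poisson_power_sum_pos[of b l] assms
  by (simp add: H_GR2_def ln_div flip: poisson_power_sum_def)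

lemma H_GR2_commute:
  assumes "0 < a" "0 < b" "0 < l"
  shows "H_GR2 a b l = H_GR2 b a l"
  using assms by (simp add: H_GR2_eq) (metis minus_diff_eq minus_divide_divide)

text \<open>\<open>H_GR2 a b l\<close> is the difference quotient between \<open>a\<close> and
  \<open>b\<close> of minus the logarithm of the power sum, and \<open>H_GR1 a l\<close> is the
  derivative of that function at \<open>a\<close>.\<close>

lemma H_GR2_tendsto_H_GR1:
  assumes "0 < a" "0 < l"
  shows "((\<lambda>b. H_GR2 a b l) \<longlongrightarrow> H_GR1 a l) (at a)"
proof -
  have "((\<lambda>b. - ln (poisson_power_sum b l)) has_real_derivative H_GR1 a l) (at a)"
    unfolding H_GR1_def poisson_power_sum_def[symmetric]
    using assms poisson_power_sum_pos[OF assms]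
    by (auto intro!: derivative_eq_intros poisson_power_sum_deriv_exponent)
  then have "((\<lambda>b. (- ln (poisson_power_sum b l) - - ln (poisson_power_sum a l)) / (b - a))
      \<longlongrightarrow> H_GR1 a l) (at a)"
    by (simp add: has_field_derivative_iff)
  moreover have "\<forall>\<^sub>F b in at a. (- ln (poisson_power_sum b l) - - ln (poisson_power_sum a l)) / (b - a)
      = H_GR2 a b l"
    using eventually_at_in_open'[of "{0<..}" a] assms
    by (auto elim!: eventually_mono simp: H_GR2_eq)
  ultimately show ?thesis
    by (rule Lim_transform_eventually)
qed

lemma H_GR2_decreasing_on_some_interval:
  assumes "0 < a" "0 < b" "0 < x" "x < y" "H_GR2 a b y < H_GR2 a b x"
  shows "decreasing_on_some_interval (H_GR2 a b)"
proof -
  let ?S = poisson_power_sum and ?S' = poisson_power_sum'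
  let ?f' = "\<lambda>l. (?S' a l / ?S a l - ?S' b l / ?S b l) / (b - a)"
  \<comment> \<open>For \<open>a = b\<close> division by zero makes \<open>H_GR2\<close> constantly
    0, which excludes the assumed drop.\<close>
  have "a \<noteq> b"
    using assms by (auto simp: H_GR2_def)
  show ?thesis
  proof (rule decreasing_on_some_interval_C1[of _ ?f'])
    fix l :: real assume l: "0 < l"
    have "((\<lambda>l. (ln (?S a l) - ln (?S b l)) / (b - a)) has_real_derivative ?f' l) (at l)"
      using poisson_power_sum_pos[of a l] poisson_power_sum_pos[of b l] assms l \<open>a \<noteq> b\<close>
      by (auto intro!: derivative_eq_intros poisson_power_sum_deriv)
    then show "(H_GR2 a b has_real_derivative ?f' l) (at l)"
      by (rule has_field_derivative_transform_within_open[of _ _ _ "{0<..}"])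
         (use assms l in \<open>auto simp: H_GR2_eq\<close>)
  next
    have "continuous_on {0<..} (?S c)" if "0 < c" for c
      using DERIV_isCont[OF poisson_power_sum_deriv[OF that]]
      by (auto simp: continuous_on_eq_continuous_at)
    moreover have "?S c l \<noteq> 0" if "0 < c" "0 < l" for c l
      using poisson_power_sum_pos[OF that] by simp
    ultimately show "continuous_on {0<..} ?f'"
      using assms unfolding divide_inverse[of _ "b - a"]
      by (intro continuous_intros continuous_on_poisson_power_sum') auto
  qed (use assms in auto)
qed

text \<open>The power sum for \<open>a\<close> does not fall, the one for \<open>b\<close> strictly
  falls, and \<open>b - a\<close> is positive.\<close>

lemma H_GR2_strict_mono:
  assumes "0 < a" "a \<le> 1" "1 < b"
  shows "strict_mono_on {0<..} (H_GR2 a b)"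
proof (rule strict_mono_onI)
  fix x y :: real assume xy: "x \<in> {0<..}" "y \<in> {0<..}" "x < y"
  then have "ln (poisson_power_sum a x) \<le> ln (poisson_power_sum a y)"
    "ln (poisson_power_sum b y) < ln (poisson_power_sum b x)"
    using poisson_power_sum_mono[of a x y] poisson_power_sum_strict_antimono[of b x y] assms
      poisson_power_sum_pos[of a x] poisson_power_sum_pos[of b y] by auto
  then show "H_GR2 a b x < H_GR2 a b y"
    using assms xy by (simp add: H_GR2_eq divide_strict_right_mono)
qed

text \<open>Two points \<open>x < y\<close> of the given interval are fixed before \<open>b\<close>
  varies, so convergence at these two points is enough.\<close>

lemma eventually_H_GR2_decreasing:
  assumes a: "0 < a" and "decreasing_on_some_interval (H_GR1 a)"
  shows "\<forall>\<^sub>F b in at a. decreasing_on_some_interval (H_GR2 a b)"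
proof -
  obtain u v where uv: "0 \<le> u" "u < v" "strict_antimono_on {u<..<v} (H_GR1 a)"
    using assms by (auto simp: decreasing_on_some_interval_def)
  obtain x where x: "u < x" "x < v"
    using dense uv by blast
  obtain y where y: "x < y" "y < v"
    using dense x by blast
  have "H_GR1 a y < H_GR1 a x"
    using uv(3) x y by (auto simp: monotone_on_def)
  moreover have "((\<lambda>b. H_GR2 a b x - H_GR2 a b y) \<longlongrightarrow> H_GR1 a x - H_GR1 a y) (at a)"
    using a x y uv by (intro tendsto_diff H_GR2_tendsto_H_GR1) auto
  ultimately have "\<forall>\<^sub>F b in at a. 0 < H_GR2 a b x - H_GR2 a b y"
    by (intro order_tendstoD) auto
  moreover have "\<forall>\<^sub>F b in at a. 0 < b"
    using eventually_at_in_open'[of "{0<..}" a] a by simp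
  ultimately show ?thesis
  proof eventually_elim
    case (elim b)
    then show ?case
      using H_GR2_decreasing_on_some_interval[of a b x y] a x y uv by simp
  qed
qed

theorem proposition5p8:
  shows "(\<forall>\<alpha> \<beta> :: real. \<alpha> > 0 \<and> \<beta> > 0 \<and> (\<alpha> \<le> 1 \<and> 1 < \<beta> \<or> \<alpha> > 1 \<and> 1 \<ge> \<beta>) \<longrightarrow>
            strict_mono_on {0<..} (\<lambda>l. H_GR2 \<alpha> \<beta> l)) \<and>
         (\<forall>J :: real set. (J \<subseteq> {0<..<1} \<or> J \<subseteq> {1<..}) \<and>
            (\<forall>\<alpha>\<in>J. decreasing_on_some_interval (\<lambda>l. H_GR1 \<alpha> l)) \<longrightarrow>
            (\<forall>\<alpha>\<in>J. \<forall>\<^sub>F \<beta> in at \<alpha>. decreasing_on_some_interval (\<lambda>l. H_GR2 \<alpha> \<beta> l)))"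
proof (intro conjI allI impI ballI)
  fix \<alpha> \<beta> :: real
  assume ab: "\<alpha> > 0 \<and> \<beta> > 0 \<and> (\<alpha> \<le> 1 \<and> 1 < \<beta> \<or> \<alpha> > 1 \<and> 1 \<ge> \<beta>)"
  show "strict_mono_on {0<..} (\<lambda>l. H_GR2 \<alpha> \<beta> l)"
  proof (cases "\<alpha> \<le> 1")
    case True
    then show ?thesis
      using H_GR2_strict_mono[of \<alpha> \<beta>] ab by simp
  next
    case False
    \<comment> \<open>The entropy is symmetric in its two parameters, so this case reduces to the
      first by swapping them.\<close>
    then have "strict_mono_on {0<..} (H_GR2 \<beta> \<alpha>)"
      using H_GR2_strict_mono[of \<beta> \<alpha>] ab by simp
    then show ?thesis
      using ab by (simp add: monotone_on_def H_GR2_commute[of \<beta> \<alpha>])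
  qed
next
  fix J :: "real set" and \<alpha>
  assume "(J \<subseteq> {0<..<1} \<or> J \<subseteq> {1<..}) \<and> (\<forall>\<alpha>\<in>J. decreasing_on_some_interval (\<lambda>l. H_GR1 \<alpha> l))"
    and "\<alpha> \<in> J"
  then have "0 < \<alpha>" "decreasing_on_some_interval (H_GR1 \<alpha>)"
    by fastforce+
  then show "\<forall>\<^sub>F \<beta> in at \<alpha>. decreasing_on_some_interval (\<lambda>l. H_GR2 \<alpha> \<beta> l)"
    by (rule eventually_H_GR2_decreasing)
qed

end
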